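(* Let $n\ge1$, let $(a_k)_{k\ge1}$ and $(w_k)_{k\ge 1}$ be complex numbers with $a_1=1$ and $w_1=1$, and let $A_n=W_n+D_n$, where $D_n$ is the $n\times n$ matrix whose $(i,j)$ entry is $a_{j/i}$ if $i\mid j$ and $0$ otherwise, and $W_n$ is the $n\times n$ matrix whose first column is $(0,w_2,\dots,w_n)^T$ and whose other entries are zero. Let $\lambda\neq1$ be an eigenvalue of $A_n$. Then the eigenspace of $A_n^T$ associated with $\lambda$ is one-dimensional, and a basis for it is the vector $$v=\big[1,\;Y_\lambda(2),\;Y_\lambda(3),\;\dots,\;Y_\lambda(n)\big]^T,$$ where $$Y_\lambda(q)=\sum_{k\ge0}\frac{d(q,k)}{(\lambda-1)^k}=d(q,0)+\frac{d(q,1)}{\lambda-1}+\frac{d(q,2)}{(\lambda-1)^2}+\cdots$$ and $d(q,k)$ is defined in the context.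
   Context: Let $L(s)=\sum_{k=1}^{\infty}a_k k^{-s}$ be the formal Dirichlet series with coefficients $a_k$, $a_1=1$. For integers $m\ge1$ and $k\ge0$, $d(m,k)$ denotes the coefficient of $m^{-s}$ in the formal Dirichlet series $(L(s)-1)^k=\big(\sum_{m\ge2}a_m m^{-s}\big)^k=\sum_{m\ge1}d(m,k)m^{-s}$ (product = Dirichlet convolution; the $0$th power is the series $1$, so $d(1,0)=1$ and $d(m,0)=0$ for $m>1$). Since $d(m,k)=0$ whenever $m<2^k$, the sums defining $Y_\lambda(q)$ are finite. *)

theory Defs
  imports Complex_Main "Jordan_Normal_Form.Char_Poly" "Jordan_Normal_Form.Matrix_Kernel"
begin

text \<open>
  A formal Dirichlet series is represented by its coefficient function
  \<open>f :: nat \<Rightarrow> complex\<close>, where \<open>f m\<close> is the coefficient of \<open>m\<^sup>-\<^sup>s\<close>. Only the values at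
  \<open>m \<ge> 1\<close> are meaningful, and no coefficient at \<open>m \<ge> 1\<close> depends on a value at \<open>0\<close>.
\<close>

definition dirichlet_one :: "nat \<Rightarrow> complex" where
  "dirichlet_one m = (if m = 1 then 1 else 0)"

definition dirichlet_conv :: "(nat \<Rightarrow> complex) \<Rightarrow> (nat \<Rightarrow> complex) \<Rightarrow> nat \<Rightarrow> complex" where
  "dirichlet_conv f g m = (\<Sum>e | e dvd m. f e * g (m div e))"

primrec dirichlet_power :: "(nat \<Rightarrow> complex) \<Rightarrow> nat \<Rightarrow> nat \<Rightarrow> complex" where
  "dirichlet_power f 0 = dirichlet_one"
| "dirichlet_power f (Suc k) = dirichlet_conv f (dirichlet_power f k)"

text \<open>The coefficient of \<open>m\<^sup>-\<^sup>s\<close> in \<open>(L(s) - 1)\<^sup>k\<close>, where \<open>L\<close> has the coefficients \<open>a\<close>.\<close>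

definition dcoeff :: "(nat \<Rightarrow> complex) \<Rightarrow> nat \<Rightarrow> nat \<Rightarrow> complex" where
  "dcoeff a m k = dirichlet_power (\<lambda>j. a j - dirichlet_one j) k m"

text \<open>
  For \<open>a 1 = 1\<close> and \<open>q \<ge> 1\<close> this series has only finitely many nonzero terms;
  see \<open>Y_fun_finite\<close> below.
\<close>

definition Y_fun :: "(nat \<Rightarrow> complex) \<Rightarrow> complex \<Rightarrow> nat \<Rightarrow> complex" where
  "Y_fun a l q = (\<Sum>k. dcoeff a q k / (l - 1) ^ k)"

text \<open>
  Matrix and vector indices start at \<open>0\<close> in the library, so that the library's entry
  \<open>(i, j)\<close> is the entry \<open>(i + 1, j + 1)\<close> in one-based numbering.
\<close>

definition D_mat :: "(nat \<Rightarrow> complex) \<Rightarrow> nat \<Rightarrow> complex mat" where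
  "D_mat a n = mat n n (\<lambda>(i, j). if (i + 1) dvd (j + 1) then a ((j + 1) div (i + 1)) else 0)"

definition W_mat :: "(nat \<Rightarrow> complex) \<Rightarrow> nat \<Rightarrow> complex mat" where
  "W_mat w n = mat n n (\<lambda>(i, j). if j = 0 \<and> i \<noteq> 0 then w (i + 1) else 0)"

definition A_mat :: "(nat \<Rightarrow> complex) \<Rightarrow> (nat \<Rightarrow> complex) \<Rightarrow> nat \<Rightarrow> complex mat" where
  "A_mat a w n = W_mat w n + D_mat a n"

definition Y_vec :: "(nat \<Rightarrow> complex) \<Rightarrow> complex \<Rightarrow> nat \<Rightarrow> complex vec" where
  "Y_vec a l n = vec n (\<lambda>i. if i = 0 then 1 else Y_fun a l (i + 1))"

definition eigenspace :: "complex mat \<Rightarrow> complex \<Rightarrow> complex vec set" where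
  "eigenspace A l = {x \<in> carrier_vec (dim_row A). A *\<^sub>v x = l \<cdot>\<^sub>v x}"

text \<open>The eigenspace as a vector space, with the operations of the ambient space.\<close>

definition eigenspace_vs :: "complex mat \<Rightarrow> complex \<Rightarrow> (complex, complex vec) module" where
  "eigenspace_vs A l = module_vec TYPE(complex) (dim_row A) \<lparr>carrier := eigenspace A l\<rparr>"

lemma eigenspace_eq_mat_kernel:
  assumes A: "A \<in> carrier_mat n n"
  shows "eigenspace A l = mat_kernel (char_matrix A l)"
proof -
  have C: "char_matrix A l \<in> carrier_mat n n" using A by simp
  have "A *\<^sub>v x = l \<cdot>\<^sub>v x \<longleftrightarrow> char_matrix A l *\<^sub>v x = 0\<^sub>v n" if x: "x \<in> carrier_vec n" for x
  proof -
    have "(- l \<cdot>\<^sub>m 1\<^sub>m n) *\<^sub>v x = - l \<cdot>\<^sub>v x"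
      using x by (intro eq_vecI) auto
    then have "char_matrix A l *\<^sub>v x = A *\<^sub>v x + (- l) \<cdot>\<^sub>v x"
      using A x add_mult_distrib_mat_vec[of A n n "- l \<cdot>\<^sub>m 1\<^sub>m n" x]
      by (simp add: char_matrix_def)
    then show ?thesis
      using A x by (auto simp: vec_eq_iff)
  qed
  then show ?thesis
    using A C unfolding eigenspace_def mat_kernel[OF C] by auto
qed

lemma vectorspace_eigenspace_vs:
  assumes A: "A \<in> carrier_mat n n"
  shows "vectorspace class_ring (eigenspace_vs A l)"
proof -
  have C: "char_matrix A l \<in> carrier_mat n n" using A by simp
  have eq: "eigenspace_vs A l =
    module_vec TYPE(complex) n \<lparr>carrier := mat_kernel (char_matrix A l)\<rparr>"
    using A by (simp add: eigenspace_vs_def eigenspace_eq_mat_kernel)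
  interpret kernel n n "char_matrix A l"
    using C by unfold_locales
  show ?thesis
    unfolding eq by (rule Ker.vectorspace_axioms)
qed

lemma dcoeff_zero: "dcoeff a m 0 = (if m = 1 then 1 else 0)"
  by (simp add: dcoeff_def dirichlet_one_def)

lemma dcoeff_eq_0:
  assumes "a 1 = 1" "m \<ge> 1" "m < 2 ^ k"
  shows "dcoeff a m k = 0"
  using assms(2,3)
proof (induction k arbitrary: m)
  case 0
  then show ?case by simp
next
  case (Suc k)
  have "(a e - dirichlet_one e) * dcoeff a (m div e) k = 0" if e: "e dvd m" for e
  proof (cases "e = 1")
    case True
    then show ?thesis using assms(1) by (simp add: dirichlet_one_def)
  next
    case False
    from e Suc.prems have "e \<noteq> 0" by auto
    with False have e2: "e \<ge> 2" by simp
    have m: "m = e * (m div e)" using e by simp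
    then have pos: "m div e \<ge> 1" using Suc.prems by (cases "m div e = 0") auto
    have "2 * (m div e) \<le> m" using e2 m by (metis mult_le_mono1)
    then have "m div e < 2 ^ k" using Suc.prems by simp
    with pos show ?thesis using Suc.IH by simp
  qed
  then show ?case
    by (auto simp: dcoeff_def dirichlet_conv_def intro!: sum.neutral)
qed

lemma Y_fun_finite:
  assumes "a 1 = 1" "q \<ge> 1" "q < 2 ^ N"
  shows "Y_fun a l q = (\<Sum>k<N. dcoeff a q k / (l - 1) ^ k)"
  unfolding Y_fun_def
proof (rule suminf_finite)
  fix k assume "k \<notin> {..<N}"
  then have "q < 2 ^ k"
    using assms(3) by (meson lessThan_iff linorder_not_less one_le_numeral order_less_le_trans power_increasing)
  then show "dcoeff a q k / (l - 1) ^ k = 0"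
    using dcoeff_eq_0 assms by simp
qed simp

end

theory Submission
  imports Defs
begin

text \<open>
  Row \<open>q > 1\<close> of the eigenvector equation for the transpose expresses \<open>(l - 1) x\<^sub>q\<close> through the
  entries of \<open>x\<close> at the proper divisors of \<open>q\<close>, so an eigenvector is determined by \<open>x\<^sub>1\<close>, and
  \<open>Y\<close> solves the same recursion. The first row need not be checked for \<open>Y\<close>: the transpose has
  the same eigenvalues, so some nonzero \<open>x\<close> satisfies all rows, and it is a multiple of \<open>Y\<close>.
\<close>

lemma Y_fun_1:
  assumes "a 1 = 1"
  shows "Y_fun a l 1 = 1"
  using Y_fun_finite[of a 1 1 l] assms by (simp add: dcoeff_zero)

text \<open>Peeling one factor off the convolution power leaves a sum over divisors. Passing to
  complementary divisors moves the recursion onto the coefficients at \<open>e\<close>.\<close>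

lemma dcoeff_Suc_proper_divisors:
  assumes "a 1 = 1" "q \<ge> 1"
  shows "dcoeff a q (Suc k) = (\<Sum>e | e dvd q \<and> e \<noteq> q. a (q div e) * dcoeff a e k)"
proof -
  have "dcoeff a q (Suc k) = (\<Sum>e | e dvd q. (a e - dirichlet_one e) * dcoeff a (q div e) k)"
    by (simp add: dcoeff_def dirichlet_conv_def)
  also have "\<dots> = (\<Sum>e | e dvd q. (a (q div e) - dirichlet_one (q div e)) * dcoeff a e k)"
    using assms(2) by (intro sum.reindex_bij_witness[where i = "\<lambda>e. q div e" and j = "\<lambda>e. q div e"])
      (auto simp: div_dvd_iff_mult)
  also have "\<dots> = (\<Sum>e | e dvd q \<and> e \<noteq> q. a (q div e) * dcoeff a e k)"
  \<comment> \<open>The term \<open>e = q\<close> vanishes because \<open>a 1 - 1 = 0\<close>. For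
    every other divisor \<open>q div e\<close> differs from 1, so \<open>dirichlet_one\<close>
    contributes nothing.\<close>
  proof (rule sum.mono_neutral_cong_right)
    show "finite {e. e dvd q}" using assms(2) by simp
    show "\<forall>e\<in>{e. e dvd q} - {e. e dvd q \<and> e \<noteq> q}.
        (a (q div e) - dirichlet_one (q div e)) * dcoeff a e k = 0"
      using assms by (auto simp: dirichlet_one_def)
    show "(a (q div e) - dirichlet_one (q div e)) * dcoeff a e k = a (q div e) * dcoeff a e k"
      if "e \<in> {e. e dvd q \<and> e \<noteq> q}" for e
      using that assms(2) by (auto simp: dirichlet_one_def elim!: dvdE)
  qed auto
  finally show ?thesis .
qed

text \<open>Multiplication by \<open>l - 1\<close> shifts the summation index: the term
  \<open>k = 0\<close> is zero for \<open>q > 1\<close>, and each remaining coefficient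
  \<open>dcoeff a q (Suc k)\<close> unfolds over proper divisors. Exchanging the two finite sums
  reassembles \<open>Y_fun\<close> at these divisors.\<close>

lemma Y_fun_rec:
  assumes "a 1 = 1" "l \<noteq> 1" "q > 1"
  shows "(l - 1) * Y_fun a l q = (\<Sum>e | e dvd q \<and> e \<noteq> q. a (q div e) * Y_fun a l e)"
proof -
  have "q < (2::nat) ^ q" by simp
  also have "\<dots> < 2 ^ Suc q" by simp
  finally have q: "q < 2 ^ Suc q" .
  \<comment> \<open>The truncation at \<open>Suc q\<close> leaves \<open>q\<close> terms after the
    shift. These still give the exact value at each divisor \<open>e\<close> of \<open>q\<close>,
    since \<open>e <= q < 2 ^ q\<close>.\<close>
  have "(l - 1) * Y_fun a l q = (l - 1) * (\<Sum>k<Suc q. dcoeff a q k / (l - 1) ^ k)"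
    using Y_fun_finite[of a q "Suc q" l] assms q by simp
  also have "\<dots> = (\<Sum>k<q. dcoeff a q (Suc k) / (l - 1) ^ k)"
    using assms unfolding sum.lessThan_Suc_shift
    by (simp add: dcoeff_zero sum_distrib_left)
  also have "\<dots> = (\<Sum>k<q. \<Sum>e | e dvd q \<and> e \<noteq> q. a (q div e) * (dcoeff a e k / (l - 1) ^ k))"
    using assms by (simp add: dcoeff_Suc_proper_divisors sum_divide_distrib)
  also have "\<dots> = (\<Sum>e | e dvd q \<and> e \<noteq> q. a (q div e) * (\<Sum>k<q. dcoeff a e k / (l - 1) ^ k))"
    by (subst sum.swap) (simp add: sum_distrib_left)
  also have "\<dots> = (\<Sum>e | e dvd q \<and> e \<noteq> q. a (q div e) * Y_fun a l e)"
  proof (rule sum.cong)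
    fix e assume "e \<in> {e. e dvd q \<and> e \<noteq> q}"
    then have e: "e \<ge> 1" "e \<le> q" using assms(3) by (auto simp: dvd_imp_le dest: dvd_pos_nat)
    have "e < 2 ^ q" using e(2) \<open>q < 2 ^ q\<close> by (rule le_less_trans)
    then show "a (q div e) * (\<Sum>k<q. dcoeff a e k / (l - 1) ^ k) = a (q div e) * Y_fun a l e"
      using Y_fun_finite[of a e q l] assms(1) e by simp
  qed simp
  finally show ?thesis .
qed

text \<open>\<open>W_mat\<close> is supported in column 0, so for \<open>j > 0\<close> only
  \<open>D_mat\<close> contributes. The divisors \<open>e\<close> are one-based, whence the index
  \<open>e - 1\<close>.\<close>

lemma transpose_A_mat_mult_vec_index:
  assumes "0 < j" "j < n" "x \<in> carrier_vec n"
  shows "(transpose_mat (A_mat a w n) *\<^sub>v x) $ j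
    = (\<Sum>e | e dvd Suc j. a (Suc j div e) * x $ (e - 1))"
proof -
  have "(transpose_mat (A_mat a w n) *\<^sub>v x) $ j
      = (\<Sum>i<n. if Suc i dvd Suc j then a (Suc j div Suc i) * x $ i else 0)"
    using assms by (auto simp: A_mat_def W_mat_def D_mat_def scalar_prod_def lessThan_atLeast0
        intro!: sum.cong)
  also have "\<dots> = (\<Sum>i | i < n \<and> Suc i dvd Suc j. a (Suc j div Suc i) * x $ i)"
    by (simp add: sum.If_cases lessThan_def Collect_conj_eq)
  also have "\<dots> = (\<Sum>e | e dvd Suc j. a (Suc j div e) * x $ (e - 1))"
  proof (rule sum.reindex_bij_witness[where i = "\<lambda>e. e - 1" and j = Suc])
    fix e assume "e \<in> {e. e dvd Suc j}"
    \<comment> \<open>A divisor of \<open>Suc j\<close> is at most \<open>Suc j <= n\<close>, so the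
      range \<open>i < n\<close> misses none of them.\<close>
    then have e: "e dvd Suc j" "e \<noteq> 0" "e \<le> Suc j" by (auto simp: dvd_imp_le intro: ccontr)
    then show "Suc (e - 1) = e" and "e - 1 \<in> {i. i < n \<and> Suc i dvd Suc j}"
      using assms(2) by auto
  qed auto
  finally show ?thesis .
qed

lemma eigenspace_transpose_A_mat_multiple:
  assumes "a 1 = 1" "l \<noteq> 1" "x \<in> eigenspace (transpose_mat (A_mat a w n)) l"
  shows "x = x $ 0 \<cdot>\<^sub>v Y_vec a l n"
proof (rule eq_vecI)
  have x: "x \<in> carrier_vec n" and ev: "transpose_mat (A_mat a w n) *\<^sub>v x = l \<cdot>\<^sub>v x"
    using assms(3) by (auto simp: eigenspace_def A_mat_def D_mat_def)
  then show "dim_vec x = dim_vec (x $ 0 \<cdot>\<^sub>v Y_vec a l n)"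
    by (simp add: Y_vec_def)
  have multiple: "x $ j = x $ 0 * Y_fun a l (Suc j)" if "j < n" for j
    using that
  proof (induction j rule: less_induct)
    case (less j)
    show ?case
    proof (cases "j = 0")
      case True
      then show ?thesis using Y_fun_1[of a l] assms(1) by simp
    next
      case False
      have "l * x $ j = (\<Sum>e | e dvd Suc j. a (Suc j div e) * x $ (e - 1))"
        using transpose_A_mat_mult_vec_index[of j n x a w] False less.prems x ev by simp
      \<comment> \<open>The diagonal term \<open>e = Suc j\<close> equals
        \<open>a 1 * x $ j = x $ j\<close>. Moving it to the left turns the factor \<open>l\<close>
        into \<open>l - 1\<close>, which can be cancelled at the end.\<close>
      also have "{e. e dvd Suc j} = insert (Suc j) {e. e dvd Suc j \<and> e \<noteq> Suc j}"
        by auto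
      also have "(\<Sum>e\<in>\<dots>. a (Suc j div e) * x $ (e - 1))
          = x $ j + (\<Sum>e | e dvd Suc j \<and> e \<noteq> Suc j. a (Suc j div e) * x $ (e - 1))"
        using assms(1) by (subst sum.insert) auto
      also have "(\<Sum>e | e dvd Suc j \<and> e \<noteq> Suc j. a (Suc j div e) * x $ (e - 1))
          = (\<Sum>e | e dvd Suc j \<and> e \<noteq> Suc j. a (Suc j div e) * (x $ 0 * Y_fun a l e))"
      proof (rule sum.cong)
        fix e assume "e \<in> {e. e dvd Suc j \<and> e \<noteq> Suc j}"
        then have "e \<noteq> 0" "e \<le> Suc j" "e \<noteq> Suc j" by (auto simp: dvd_imp_le intro: ccontr)
        \<comment> \<open>A proper divisor \<open>e\<close> of \<open>Suc j\<close> sits at index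
          \<open>e - 1 < j\<close>, within reach of the induction hypothesis.\<close>
        then have "x $ (e - 1) = x $ 0 * Y_fun a l (Suc (e - 1))" "Suc (e - 1) = e"
          using less.IH[of "e - 1"] less.prems by auto
        then show "a (Suc j div e) * x $ (e - 1) = a (Suc j div e) * (x $ 0 * Y_fun a l e)"
          by simp
      qed simp
      also have "\<dots> = x $ 0 * (\<Sum>e | e dvd Suc j \<and> e \<noteq> Suc j. a (Suc j div e) * Y_fun a l e)"
        by (simp add: sum_distrib_left mult.left_commute)
      also have "\<dots> = x $ 0 * ((l - 1) * Y_fun a l (Suc j))"
        using Y_fun_rec[of a l "Suc j"] assms False by simp
      finally have "(l - 1) * x $ j = (l - 1) * (x $ 0 * Y_fun a l (Suc j))"
        by (simp add: algebra_simps)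
      then show ?thesis using assms(2) by simp
    qed
  qed
  show "x $ j = (x $ 0 \<cdot>\<^sub>v Y_vec a l n) $ j"
    if "j < dim_vec (x $ 0 \<cdot>\<^sub>v Y_vec a l n)" for j
    using that multiple[of j] by (cases "j = 0") (auto simp: Y_vec_def)
qed

lemma Y_vec_in_eigenspace:
  assumes "a 1 = 1" "l \<noteq> 1" "eigenvalue (A_mat a w n) l"
  shows "Y_vec a l n \<in> eigenspace (transpose_mat (A_mat a w n)) l"
proof -
  let ?B = "transpose_mat (A_mat a w n)"
  have A: "A_mat a w n \<in> carrier_mat n n" by (simp add: A_mat_def D_mat_def)
  then have B: "?B \<in> carrier_mat n n" by simp
  \<comment> \<open>Eigenvalues are the roots of the characteristic polynomial, which a matrix
    shares with its transpose.\<close>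
  have "eigenvalue ?B l"
    using assms(3) eigenvalue_root_char_poly[OF A] eigenvalue_root_char_poly[OF B]
    by (simp add: char_poly_transpose_mat[OF A])
  then obtain x where x: "x \<in> carrier_vec n" "x \<noteq> 0\<^sub>v n" "?B *\<^sub>v x = l \<cdot>\<^sub>v x"
    using B by (auto simp: eigenvalue_def eigenvector_def)
  then have "x = x $ 0 \<cdot>\<^sub>v Y_vec a l n"
    using B assms by (intro eigenspace_transpose_A_mat_multiple) (auto simp: eigenspace_def)
  \<comment> \<open>Naming the scalar frees the right-hand side of \<open>x\<close>, so that the
    equation can eliminate \<open>x\<close>.\<close>
  then obtain c where x_eq: "x = c \<cdot>\<^sub>v Y_vec a l n" by blast
  have Y: "Y_vec a l n \<in> carrier_vec n" by (simp add: Y_vec_def)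
  have "c \<noteq> 0"
    using x(2) x_eq Y by auto
  then have "Y_vec a l n = inverse c \<cdot>\<^sub>v x"
    by (simp add: x_eq smult_smult_assoc)
  then show ?thesis
    using x B Y by (auto simp: eigenspace_def mult_mat_vec smult_smult_assoc mult.commute)
qed

lemma (in vectorspace) basis_singletonI:
  assumes v: "v \<in> carrier V" "v \<noteq> \<zero>\<^bsub>V\<^esub>"
    and gen: "\<And>x. x \<in> carrier V \<Longrightarrow> \<exists>c\<in>carrier K. x = c \<odot>\<^bsub>V\<^esub> v"
  shows "basis {v}"
proof -
  have lincomb: "lincomb f {v} = f v \<odot>\<^bsub>V\<^esub> v" if "f v \<in> carrier K" for f
    using that v(1) by (simp add: lincomb_def)
  have "lin_indpt {v}"
  proof (rule notI)
    assume "lin_dep {v}"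
    then obtain A f u where A: "A \<subseteq> {v}" "f \<in> A \<rightarrow> carrier K" "lincomb f A = \<zero>\<^bsub>V\<^esub>"
      "u \<in> A" "f u \<noteq> \<zero>\<^bsub>K\<^esub>"
      unfolding lin_dep_def by blast
    then have "A = {v}" "u = v" by auto
    with A have c: "f v \<in> carrier K" "f v \<noteq> \<zero>\<^bsub>K\<^esub>" "f v \<odot>\<^bsub>V\<^esub> v = \<zero>\<^bsub>V\<^esub>"
      using lincomb[of f] by auto
    \<comment> \<open>A nonzero coefficient in a field is invertible; multiplying the relation by
      its inverse would force \<open>v\<close> to be zero.\<close>
    then have "f v \<in> Units K" using field.field_Units by simp
    then have "v = (inv\<^bsub>K\<^esub> f v \<otimes>\<^bsub>K\<^esub> f v) \<odot>\<^bsub>V\<^esub> v" "inv\<^bsub>K\<^esub> f v \<in> carrier K"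
      using v(1) by simp_all
    then have "v = inv\<^bsub>K\<^esub> f v \<odot>\<^bsub>V\<^esub> (f v \<odot>\<^bsub>V\<^esub> v)"
      using v(1) c(1) smult_assoc1 by simp
    with v c show False
      using smult_r_null \<open>inv\<^bsub>K\<^esub> f v \<in> carrier K\<close> by simp
  qed
  moreover have "x \<in> span {v}" if x: "x \<in> carrier V" for x
  proof -
    obtain c where "c \<in> carrier K" "x = c \<odot>\<^bsub>V\<^esub> v"
      using gen x by blast
    then have "lincomb (\<lambda>_. c) {v} = x" using lincomb by simp
    then show ?thesis
      using \<open>c \<in> carrier K\<close> unfolding span_def by blast
  qed
  moreover have "span {v} \<subseteq> carrier V"
    using span_is_subset2[of "{v}"] v(1) by simp
  ultimately show ?thesis
    using v(1) unfolding basis_def by auto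
qed

theorem theorem4p2:
  fixes n :: nat and a w :: "nat \<Rightarrow> complex" and l :: complex
  assumes "n \<ge> 1"
    and "a 1 = 1" and "w 1 = 1"
    and "eigenvalue (A_mat a w n) l" and "l \<noteq> 1"
  shows "vectorspace.dim class_ring (eigenspace_vs (transpose_mat (A_mat a w n)) l) = 1
    \<and> vectorspace.basis class_ring (eigenspace_vs (transpose_mat (A_mat a w n)) l) {Y_vec a l n}"
proof -
  let ?B = "transpose_mat (A_mat a w n)"
  have B: "?B \<in> carrier_mat n n" by (simp add: A_mat_def D_mat_def)
  interpret V: vectorspace class_ring "eigenspace_vs ?B l"
    by (rule vectorspace_eigenspace_vs[OF B])
  \<comment> \<open>Index 0 is in range as \<open>n >= 1\<close>, and there the entries are 1 and
    0.\<close>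
  have "Y_vec a l n $ 0 \<noteq> 0\<^sub>v n $ 0"
    using assms(1) by (simp add: Y_vec_def)
  then have "Y_vec a l n \<noteq> 0\<^sub>v n" by metis
  moreover have "Y_vec a l n \<in> eigenspace ?B l"
    using assms by (intro Y_vec_in_eigenspace)
  ultimately have basis: "V.basis {Y_vec a l n}"
    using eigenspace_transpose_A_mat_multiple[of a l _ w n] assms B
    by (intro V.basis_singletonI) (auto simp: eigenspace_vs_def module_vec_simps class_ring_simps)
  then show ?thesis
    using V.dim_basis[of "{Y_vec a l n}"] by simp
qed

end
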